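(* For every integer $n\ge 0$, \[ \binom{2n}{n}^3=[(xyz)^n]\,(1+x+y+z)^{2n}(1+x+y-z)^n(1+x-y+z)^n . \]
   Context: Here $x,y,z$ are indeterminates, and $[(xyz)^n]$ denotes the coefficient of the monomial $x^ny^nz^n$ in the polynomial that follows. *)

theory Defs
  imports Complex_Main "HOL-Library.Poly_Mapping"
begin

datatype indet = Ind_x | Ind_y | Ind_z

(* Z[x,y,z]: finitely supported maps from exponent vectors to coefficients;
   the multiplication of Poly_Mapping is convolution over addition of exponents. *)
type_synonym poly_xyz = "(indet \<Rightarrow>\<^sub>0 nat) \<Rightarrow>\<^sub>0 int"

definition indeterminate :: "indet \<Rightarrow> poly_xyz" where
  "indeterminate v = Poly_Mapping.single (Poly_Mapping.single v 1) 1"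

abbreviation X :: poly_xyz where "X \<equiv> indeterminate Ind_x"
abbreviation Y :: poly_xyz where "Y \<equiv> indeterminate Ind_y"
abbreviation Z :: poly_xyz where "Z \<equiv> indeterminate Ind_z"

definition xyz_exponent :: "nat \<Rightarrow> indet \<Rightarrow>\<^sub>0 nat" where
  "xyz_exponent n = Poly_Mapping.single Ind_x n + Poly_Mapping.single Ind_y n
     + Poly_Mapping.single Ind_z n"

definition coeff_xyz :: "nat \<Rightarrow> poly_xyz \<Rightarrow> int" where
  "coeff_xyz n p = Poly_Mapping.lookup p (xyz_exponent n)"

end

theory Submission
  imports Defs
begin

text \<open>
  Put \<open>A = 1 + X\<close>, \<open>S = Y + Z\<close> and \<open>D = Y - Z\<close>. The polynomial is
  \<open>(A + S) ^ (2 * n) * (A\<^sup>2 - D\<^sup>2) ^ n\<close>. In the binomial expansion of both factors, only the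
  terms whose degree in \<open>Y\<close> and \<open>Z\<close> is \<open>2 * n\<close> contribute, and these are
  \<open>(n choose k) (2n choose 2k) (-1)^k A^(2n) D^(2k) S^(2n - 2k)\<close>. The coefficient of \<open>X^n\<close> in
  \<open>A^(2n)\<close> gives one factor \<open>2n choose n\<close>.

  What remains is the middle coefficient \<open>c j m\<close> of \<open>D^(2j) S^(2m)\<close>. Since
  \<open>S\<^sup>2 - D\<^sup>2 = 4 Y Z\<close>, it satisfies \<open>c (j+1) m = c j (m+1) - 4 c j m\<close>. The super Catalan
  numbers \<open>(2j)! (2m)! / (j! m! (j+m)!)\<close>, taken with the sign \<open>(-1)^j\<close>, satisfy the same recurrence
  and have the same values \<open>2m choose m\<close> at \<open>j = 0\<close>, so the two agree
  (lemma \<open>middle_coeff_closed_form\<close>; this is von Szily's identity). Hence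
  \<open>(2n choose 2k) c k (n-k) = (-1)^k (2n choose n) (n choose k)\<close>, the signs cancel, and the sum
  is \<open>(2n choose n)\<^sup>2\<close> times the sum of the \<open>(n choose k)\<^sup>2\<close>, which is \<open>2n choose n\<close>.
\<close>

lemma coeff_xyz_add: "coeff_xyz n (p + q) = coeff_xyz n p + coeff_xyz n q"
  by (simp add: coeff_xyz_def lookup_add)

lemma coeff_xyz_diff: "coeff_xyz n (p - q) = coeff_xyz n p - coeff_xyz n q"
  by (simp add: coeff_xyz_def lookup_minus)

lemma coeff_xyz_0: "coeff_xyz n 0 = 0"
  by (simp add: coeff_xyz_def)

lemma coeff_xyz_sum: "coeff_xyz n (\<Sum>i\<in>I. f i) = (\<Sum>i\<in>I. coeff_xyz n (f i))"
  by (induction I rule: infinite_finite_induct) (simp_all add: coeff_xyz_0 coeff_xyz_add)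

lemma coeff_xyz_of_int_mult: "coeff_xyz n (of_int c * p) = c * coeff_xyz n p"
  by (induction c rule: int_induct[where k = 0])
     (simp_all add: coeff_xyz_0 coeff_xyz_add coeff_xyz_diff algebra_simps)

lemma coeff_xyz_of_nat_mult: "coeff_xyz n (of_nat c * p) = int c * coeff_xyz n p"
  using coeff_xyz_of_int_mult[of n "int c" p] by simp

lemma indeterminate_power:
  "indeterminate v ^ a = Poly_Mapping.single (Poly_Mapping.single v a) 1"
  by (induction a) (simp_all add: indeterminate_def mult_single flip: single_add)

lemma coeff_xyz_monomial:
  "coeff_xyz n (X ^ a * Y ^ b * Z ^ c) = (if a = n \<and> b = n \<and> c = n then 1 else 0)"
proof -
  let ?e = "Poly_Mapping.single Ind_x a + Poly_Mapping.single Ind_y b + Poly_Mapping.single Ind_z c"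
  have "?e = xyz_exponent n \<longleftrightarrow> a = n \<and> b = n \<and> c = n"
  proof
    assume e: "?e = xyz_exponent n"
    have "Poly_Mapping.lookup ?e v = Poly_Mapping.lookup (xyz_exponent n) v" for v
      using e by simp
    from this[of Ind_x] this[of Ind_y] this[of Ind_z]
    show "a = n \<and> b = n \<and> c = n"
      by (simp add: xyz_exponent_def lookup_add lookup_single)
  qed (simp add: xyz_exponent_def)
  then have "Poly_Mapping.lookup (Poly_Mapping.single ?e (1::int)) (xyz_exponent n) =
      (if a = n \<and> b = n \<and> c = n then 1 else 0)"
    by (simp only: lookup_single when_def)
  then show ?thesis
    by (simp add: coeff_xyz_def indeterminate_power mult_single)
qed

lemma lookup_single_mult_shift:
  fixes q :: "('a::cancel_comm_monoid_add) \<Rightarrow>\<^sub>0 int"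
  shows "Poly_Mapping.lookup (Poly_Mapping.single k v * q) (k + e) = v * Poly_Mapping.lookup q e"
  by (simp add: lookup_mult lookup_single when_mult mult_when)

lemma coeff_xyz_shift: "coeff_xyz (Suc n) (X * Y * Z * q) = coeff_xyz n q"
proof -
  have "X * Y * Z = Poly_Mapping.single (xyz_exponent 1) 1"
    by (simp add: indeterminate_def mult_single xyz_exponent_def)
  moreover have "xyz_exponent (Suc n) = xyz_exponent 1 + xyz_exponent n"
  proof -
    have "Poly_Mapping.single v (Suc n) = Poly_Mapping.single v 1 + Poly_Mapping.single v n"
      for v :: indet
      by (simp flip: single_add)
    then show ?thesis
      by (simp only: xyz_exponent_def ac_simps)
  qed
  ultimately show ?thesis
    by (simp add: coeff_xyz_def lookup_single_mult_shift)
qed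

text \<open>The polynomial is homogeneous of degree \<open>l\<close> in \<open>X\<close> and of degree \<open>a + i\<close> in \<open>Y, Z\<close> jointly.\<close>
lemma coeff_xyz_homogeneous_zero:
  assumes "l \<noteq> n \<or> a + i \<noteq> 2 * n"
  shows "coeff_xyz n (X ^ l * ((Y - Z) ^ a * (Y + Z) ^ i)) = 0"
proof -
  have term_zero: "coeff_xyz n (X ^ l * ((of_nat (a choose p) * Y ^ p * (- Z) ^ (a - p)) *
      (of_nat (i choose q) * Y ^ q * Z ^ (i - q)))) = 0" if "p \<le> a" "q \<le> i" for p q
  proof -
    have "X ^ l * ((of_nat (a choose p) * Y ^ p * (- Z) ^ (a - p)) *
        (of_nat (i choose q) * Y ^ q * Z ^ (i - q))) =
      of_int (int (a choose p) * int (i choose q) * (- 1) ^ (a - p)) *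
        (X ^ l * Y ^ (p + q) * Z ^ ((a - p) + (i - q)))"
      by (simp add: power_minus[of Z] power_add mult_ac)
    then show ?thesis
      using assms that by (simp only: coeff_xyz_of_int_mult coeff_xyz_monomial) auto
  qed
  have D: "(Y - Z) ^ a = (\<Sum>p\<le>a. of_nat (a choose p) * Y ^ p * (- Z) ^ (a - p))"
    using binomial_ring[of Y "- Z" a] by simp
  have "coeff_xyz n (X ^ l * ((Y - Z) ^ a * (Y + Z) ^ i)) =
      (\<Sum>p\<le>a. \<Sum>q\<le>i. coeff_xyz n (X ^ l * ((of_nat (a choose p) * Y ^ p * (- Z) ^ (a - p)) *
        (of_nat (i choose q) * Y ^ q * Z ^ (i - q)))))"
    by (simp only: D binomial_ring[of Y Z i] sum_product sum_distrib_left[of "X ^ l"]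
        coeff_xyz_sum)
  also have "\<dots> = (\<Sum>p\<le>a. \<Sum>q\<le>i. 0)"
    by (intro sum.cong refl, rule term_zero) auto
  finally show ?thesis by simp
qed

text \<open>
  The coefficient of \<open>(yz)^(j+m)\<close> in \<open>(y - z)^(2j) (y + z)^(2m)\<close>; the factor \<open>X ^ (j + m)\<close> lets it be
  read off as a coefficient of \<open>(xyz)^(j+m)\<close>.
\<close>
definition middle_coeff :: "nat \<Rightarrow> nat \<Rightarrow> int" where
  "middle_coeff j m = coeff_xyz (j + m) (X ^ (j + m) * ((Y - Z) ^ (2 * j) * (Y + Z) ^ (2 * m)))"

lemma middle_coeff_0: "middle_coeff 0 m = int ((2 * m) choose m)"
proof -
  have "middle_coeff 0 m =
      coeff_xyz m (\<Sum>q\<le>2*m. of_nat ((2*m) choose q) * (X ^ m * Y ^ q * Z ^ (2 * m - q)))"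
    by (simp add: middle_coeff_def binomial_ring[of Y Z] sum_distrib_left mult_ac)
  also have "\<dots> = (\<Sum>q\<le>2*m. if q = m then int ((2*m) choose q) else 0)"
    unfolding coeff_xyz_sum coeff_xyz_of_nat_mult coeff_xyz_monomial
    by (intro sum.cong) auto
  finally show ?thesis by simp
qed

lemma middle_coeff_rec: "middle_coeff (Suc j) m = middle_coeff j (Suc m) - 4 * middle_coeff j m"
proof -
  let ?q = "X ^ (j + m) * ((Y - Z) ^ (2 * j) * (Y + Z) ^ (2 * m))"
  have "X ^ Suc (j + m) * ((Y - Z) ^ (2 * Suc j) * (Y + Z) ^ (2 * m)) =
      X ^ Suc (j + m) * ((Y - Z) ^ (2 * j) * (Y + Z) ^ (2 * Suc m))
      - of_nat 4 * (X * Y * Z * ?q)"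
  proof -
    have step: "a ^ (2 * Suc k) = a ^ (2 * k) * a ^ 2" for a :: poly_xyz and k
      by (simp add: power2_eq_square mult_ac)
    have "X * x * (d * (Y - Z)^2 * s) =
        X * x * (d * (s * (Y + Z)^2)) - of_nat 4 * (X * Y * Z * (x * (d * s)))" for x d s
      by (simp add: power2_eq_square algebra_simps)
    from this[of "X ^ (j + m)" "(Y - Z) ^ (2 * j)" "(Y + Z) ^ (2 * m)"] show ?thesis
      by (simp only: step power_Suc)
  qed
  then show ?thesis
    by (simp only: middle_coeff_def add_Suc add_Suc_right coeff_xyz_diff coeff_xyz_of_nat_mult
        coeff_xyz_shift)
qed

lemma middle_coeff_closed_form:
  "real_of_int (middle_coeff j m) =
     (- 1) ^ j * fact (2 * j) * fact (2 * m) / (fact j * fact m * fact (j + m))"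
proof (induction j arbitrary: m)
  case 0
  then show ?case
    by (simp add: middle_coeff_0 binomial_fact mult_2)
next
  case (Suc j)
  \<comment> \<open>Over a common denominator the recurrence is \<open>2(2m+1) - 4(j+m+1) = -2(2j+1)\<close>.\<close>
  show ?case
    by (simp add: middle_coeff_rec Suc.IH divide_simps) (simp add: algebra_simps)
qed

lemma binomial_mult_middle_coeff:
  assumes "k \<le> n"
  shows "int ((2 * n) choose (2 * k)) * middle_coeff k (n - k) =
    (- 1) ^ k * int ((2 * n) choose n) * int (n choose k)"
proof -
  obtain m where n: "n = k + m"
    using assms le_Suc_ex by blast
  have "real (2 * n choose (2 * k)) = fact (2 * n) / (fact (2 * k) * fact (2 * m))"
    using binomial_fact[of "2 * k" "2 * n"] by (simp add: n)
  moreover have "real (2 * n choose n) = fact (2 * n) / (fact n * fact n)"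
    using binomial_fact[of n "2 * n"] by simp
  moreover have "real (n choose k) = fact n / (fact k * fact m)"
    using binomial_fact[of k n] by (simp add: n)
  moreover have "real_of_int (middle_coeff k (n - k)) =
      (- 1) ^ k * fact (2 * k) * fact (2 * m) / (fact k * fact m * fact n)"
    by (simp add: middle_coeff_closed_form n)
  ultimately have "real_of_int (int ((2 * n) choose (2 * k)) * middle_coeff k (n - k)) =
      real_of_int ((- 1) ^ k * int ((2 * n) choose n) * int (n choose k))"
    by (simp add: mult_ac)
  then show ?thesis by (simp only: of_int_eq_iff)
qed

lemma coeff_xyz_binomial_term:
  assumes "k \<le> n" "i \<le> 2 * n"
  shows "coeff_xyz n ((1 + X) ^ (2 * (n - k) + (2 * n - i)) * ((Y - Z) ^ (2 * k) * (Y + Z) ^ i)) =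
    (if i = 2 * (n - k) then int ((2 * n) choose n) * middle_coeff k (n - k) else 0)"
proof -
  define p where "p = 2 * (n - k) + (2 * n - i)"
  let ?q = "(Y - Z) ^ (2 * k) * (Y + Z) ^ i"
  have "(1 + X) ^ p * ?q = (\<Sum>l\<le>p. of_nat (p choose l) * (X ^ l * ?q))"
    unfolding add.commute[of 1 X] binomial_ring[of X 1 p] sum_distrib_right
    by (simp add: mult.assoc)
  then have "coeff_xyz n ((1 + X) ^ p * ?q) =
      (\<Sum>l\<le>p. int (p choose l) * coeff_xyz n (X ^ l * ?q))"
    by (simp add: coeff_xyz_sum coeff_xyz_of_nat_mult)
  also have "\<dots> = (\<Sum>l\<le>p. if l = n then int (p choose n) * coeff_xyz n (X ^ n * ?q) else 0)"
    by (intro sum.cong) (auto simp: coeff_xyz_homogeneous_zero)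
  also have "\<dots> = int (p choose n) * coeff_xyz n (X ^ n * ?q)"
    by (simp add: binomial_eq_0)
  also have "\<dots> = (if i = 2 * (n - k) then int ((2 * n) choose n) * middle_coeff k (n - k) else 0)"
  proof (cases "i = 2 * (n - k)")
    case True
    then have "p = 2 * n"
      using assms by (simp add: p_def)
    then show ?thesis
      using True assms by (simp add: middle_coeff_def)
  next
    case False
    then show ?thesis
      using assms by (simp add: coeff_xyz_homogeneous_zero)
  qed
  finally show ?thesis
    by (simp add: p_def)
qed

theorem corollary4p5:
  fixes n :: nat
  shows "int (((2 * n) choose n) ^ 3) =
    coeff_xyz n ((1 + X + Y + Z) ^ (2 * n) * (1 + X + Y - Z) ^ n * (1 + X - Y + Z) ^ n)"
proof -
  let ?A = "1 + X" and ?S = "Y + Z" and ?D = "Y - Z"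
  let ?B = "int ((2 * n) choose n)"
  have factors: "(1 + X + Y - Z) * (1 + X - Y + Z) = - (?D ^ 2) + ?A ^ 2"
    by (simp add: power2_eq_square algebra_simps)
  have "1 + X + Y + Z = ?S + ?A"
    by (simp add: ac_simps)
  then have "(1 + X + Y + Z) ^ (2 * n) * (1 + X + Y - Z) ^ n * (1 + X - Y + Z) ^ n =
      (- (?D ^ 2) + ?A ^ 2) ^ n * (?S + ?A) ^ (2 * n)"
    unfolding factors[symmetric] power_mult_distrib by (simp only: mult_ac)
  also have "\<dots> = (\<Sum>k\<le>n. \<Sum>i\<le>2*n.
      (of_nat (n choose k) * (- (?D ^ 2)) ^ k * (?A ^ 2) ^ (n - k)) *
      (of_nat ((2*n) choose i) * ?S ^ i * ?A ^ (2 * n - i)))"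
    unfolding binomial_ring[of "- (?D ^ 2)"] binomial_ring[of ?S] sum_product ..
  also have "\<dots> = (\<Sum>k\<le>n. \<Sum>i\<le>2*n.
      of_int ((- 1) ^ k * int (n choose k) * int ((2*n) choose i)) *
      (?A ^ (2 * (n - k) + (2 * n - i)) * (?D ^ (2 * k) * ?S ^ i)))"
    by (intro sum.cong refl)
       (simp only: power_minus[of "?D ^ 2"] power_add power_mult[of _ 2, symmetric] of_int_mult of_int_power
         of_int_minus of_int_1 of_int_of_nat_eq mult_ac)
  finally have "coeff_xyz n ((1 + X + Y + Z) ^ (2 * n) * (1 + X + Y - Z) ^ n * (1 + X - Y + Z) ^ n) =
      (\<Sum>k\<le>n. \<Sum>i\<le>2*n. (- 1) ^ k * int (n choose k) * int ((2*n) choose i) *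
        (if i = 2 * (n - k) then ?B * middle_coeff k (n - k) else 0))"
    by (simp only: coeff_xyz_sum coeff_xyz_of_int_mult)
       (intro sum.cong refl arg_cong2[where f = "(*)"] coeff_xyz_binomial_term; simp)
  also have "\<dots> = (\<Sum>k\<le>n. (- 1) ^ k * int (n choose k) *
      (?B * (int ((2 * n) choose (2 * k)) * middle_coeff k (n - k))))"
  proof (intro sum.cong refl)
    fix k assume "k \<in> {..n}"
    then have "(2 * n) choose (2 * (n - k)) = (2 * n) choose (2 * k)"
      using binomial_symmetric[of "2 * k" "2 * n"] by (simp add: diff_mult_distrib2)
    then show "(\<Sum>i\<le>2*n. (- 1) ^ k * int (n choose k) * int ((2*n) choose i) *
        (if i = 2 * (n - k) then ?B * middle_coeff k (n - k) else 0)) =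
      (- 1) ^ k * int (n choose k) * (?B * (int ((2 * n) choose (2 * k)) * middle_coeff k (n - k)))"
      by (simp add: if_distrib[of "(*) _"] mult_ac cong: if_cong)
  qed
  also have "\<dots> = (\<Sum>k\<le>n. ?B ^ 2 * int ((n choose k) ^ 2))"
  proof (intro sum.cong refl)
    fix k assume "k \<in> {..n}"
    then have "k \<le> n" by simp
    have sign: "(- 1) ^ k * ((- 1) ^ k * r) = r" for r :: int
      by (simp flip: mult.assoc power_mult_distrib)
    have "(- 1) ^ k * int (n choose k) * (?B * ((- 1) ^ k * ?B * int (n choose k))) =
        (- 1) ^ k * ((- 1) ^ k * (?B ^ 2 * int ((n choose k) ^ 2)))"
      by (simp add: power2_eq_square)
    then show "(- 1) ^ k * int (n choose k) *
        (?B * (int ((2 * n) choose (2 * k)) * middle_coeff k (n - k))) =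
      ?B ^ 2 * int ((n choose k) ^ 2)"
      by (simp only: binomial_mult_middle_coeff[OF \<open>k \<le> n\<close>] sign)
  qed
  also have "\<dots> = ?B ^ 2 * int (\<Sum>k\<le>n. (n choose k) ^ 2)"
    by (simp add: sum_distrib_left)
  also have "\<dots> = int (((2 * n) choose n) ^ 3)"
    by (simp only: choose_square_sum) (simp add: power2_eq_square power3_eq_cube)
  finally show ?thesis ..
qed

end
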